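(* Let $r\ge 1$ be an integer and let $a_1,\ldots,a_{r+1},b_1,\ldots,b_r,b,t,x,y$ be nonzero complex numbers. In each of the following identities assume that the series involved (the multiple series obtained by expanding the inner ${}_{s+1}\phi_s$ series) converge absolutely. Then \begin{align*} &\sum_{n=0}^\infty \frac{\tau(n)}{(q ; q)_n}\frac{(b,t,q/b_1,q/b_2,\cdots,q/b_r;q)_n}{(bt,q/a_1,q/a_2,\cdots,q/a_{r+1};q)_n} \left(\frac{xqb_1b_2\cdots b_r}{ya_1a_2\cdots a_{r+1}}\right)^n\\ &\qquad\times{ }_{r+2} \phi_{r+1}\left[\begin{array}{c} a_1q^{-n}, \ldots, a_{r+1}q^{-n},q/b \\ b_1q^{-n}, \ldots, b_rq^{-n},q^{1-n}/b \end{array}; q, y\right]\\ &=\sum_{k \geq 0} \frac{\tau(k)x^{k}}{(q ; q)_k}\sum_{n=0}^\infty \frac{\tau(n)}{(q; q)_n}\frac{(q/b_1,q/b_2,\cdots,q/b_r,b,tq^k;q)_n}{(q/a_1,q/a_2,\cdots,q/a_{r+1},bt;q)_n} \left(\frac{xqb_1b_2\cdots b_r}{ya_1a_2\cdots a_{r+1}}\right)^n\\ &\qquad\times{ }_{r+2} \phi_{r+1}\left[\begin{array}{c} a_1q^{-n}, \ldots, a_{r+1}q^{-n},tq^{k+n} \\ b_1q^{-n}, \ldots, b_rq^{-n},tq^{k} \end{array}; q, y\right]. \end{align*} In particular (letting $t\to\infty$), \begin{align*} &\sum_{n=0}^\infty \frac{\tau(n)}{(q ; q)_n}\frac{(b,q/b_1,q/b_2,\cdots,q/b_r;q)_n}{(q/a_1,q/a_2,\cdots,q/a_{r+1};q)_n}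 \left(\frac{xqb_1b_2\cdots b_r}{yba_1a_2\cdots a_{r+1}}\right)^n\\ &\qquad\times{ }_{r+2} \phi_{r+1}\left[\begin{array}{c} a_1q^{-n}, \ldots, a_{r+1}q^{-n},q/b \\ b_1q^{-n}, \ldots, b_rq^{-n},q^{1-n}/b \end{array}; q, y\right]\\ &=(x ; q)_{\infty} \sum_{n=0}^\infty \frac{\tau(n)}{(q,x ; q)_n} \frac{(q/b_1,q/b_2,\cdots,q/b_r,b;q)_n}{(q/a_1,q/a_2,\cdots,q/a_{r+1};q)_n} \left(\frac{xqb_1b_2\cdots b_r}{yba_1a_2\cdots a_{r+1}}\right)^n\\ &\qquad\times{ }_{r+1} \phi_{r}\left[\begin{array}{c} a_1q^{-n}, \ldots, a_{r+1}q^{-n}\\ b_1q^{-n}, \ldots, b_rq^{-n} \end{array}; q, yq^n\right], \end{align*} and (letting $t\to\infty$ and then $b\to\infty$) \begin{align*} &\sum_{n=0}^\infty \frac{q^{n^2}}{(q ; q)_n}\frac{(q/b_1,q/b_2,\cdots,q/b_r;q)_n}{(q/a_1,q/a_2,\cdots,q/a_{r+1};q)_n} \left(\frac{xb_1b_2\cdots b_r}{ya_1a_2\cdots a_{r+1}}\right)^n{ }_{r+1} \phi_r\left[\begin{array}{c} a_1q^{-n}, \ldots, a_{r+1}q^{-n} \\ b_1q^{-n}, \ldots, b_rq^{-n} \end{array}; q, y\right]\\ &=(x ; q)_{\infty} \sum_{n=0}^\infty \frac{q^{n^2}}{(q,x ; q)_n}\frac{(q/b_1,q/b_2,\cdots,q/b_r;q)_n}{(q/a_1,q/a_2,\cdots,q/a_{r+1};q)_n}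 \left(\frac{xb_1b_2\cdots b_r}{ya_1a_2\cdots a_{r+1}}\right)^n\\ &\qquad\times{ }_{r+1} \phi_r\left[\begin{array}{c} a_1q^{-n}, \ldots, a_{r+1}q^{-n} \\ b_1q^{-n}, \ldots, b_rq^{-n} \end{array}; q, yq^n\right]. \end{align*}
   Context: $q$ is a complex number with $0<|q|<1$. Notation: $(a;q)_\infty=\prod_{k\ge 0}(1-aq^k)$ and $(a;q)_n=(a;q)_\infty/(aq^n;q)_\infty$ for $n\in\mathbb{Z}$, i.e. $(a;q)_n=\prod_{k=0}^{n-1}(1-aq^k)$ for $n\ge 0$; $(a_1,\ldots,a_m;q)_n=\prod_{k=1}^m (a_k;q)_n$; $\tau(n)=(-1)^nq^{n(n-1)/2}$. The basic hypergeometric series is $${}_{r}\phi_s\left[\begin{array}{c} a_1,\ldots,a_r\\ b_1,\ldots,b_s\end{array};q,x\right]=\sum_{n=0}^\infty\frac{(a_1,\ldots,a_r;q)_n}{(b_1,\ldots,b_s;q)_n}\tau(n)^{s+1-r}\frac{x^n}{(q;q)_n}.$$ All parameters are assumed to be such that no zero factors occur in denominators. *)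

theory Defs
  imports "HOL-Analysis.Analysis"
begin

definition qpoch :: "complex \<Rightarrow> complex \<Rightarrow> nat \<Rightarrow> complex" where
  "qpoch a q n = (\<Prod>k<n. 1 - a * q ^ k)"

definition qpoch_inf :: "complex \<Rightarrow> complex \<Rightarrow> complex" where
  "qpoch_inf a q = (\<Prod>k. 1 - a * q ^ k)"

text \<open>The quotient form of the finite symbol, stated without division so that it also covers
  the case where the infinite products vanish.\<close>

lemma qpoch_mult_qpoch_inf:
  assumes "norm q < 1"
  shows "qpoch a q n * qpoch_inf (a * q ^ n) q = qpoch_inf a q"
proof -
  have lim: "(\<lambda>N. qpoch c q N) \<longlonglongrightarrow> qpoch_inf c q" for c
  proof -
    have "summable (\<lambda>k. norm (1 - c * q ^ k - 1))"
      using assms by (simp add: norm_mult norm_power summable_mult summable_geometric)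
    then have "convergent_prod (\<lambda>k. 1 - c * q ^ k)"
      by (intro abs_convergent_prod_imp_convergent_prod summable_imp_abs_convergent_prod)
    from convergent_prod_LIMSEQ[OF this]
    have "(\<lambda>N. qpoch c q (Suc N)) \<longlonglongrightarrow> qpoch_inf c q"
      unfolding qpoch_def qpoch_inf_def lessThan_Suc_atMost .
    then show ?thesis
      by (rule LIMSEQ_imp_Suc)
  qed
  have "qpoch a q (N + n) = qpoch a q n * qpoch (a * q ^ n) q N" for N
    by (induction N) (simp_all add: qpoch_def power_add mult_ac)
  then have "(\<lambda>N. qpoch a q (N + n)) \<longlonglongrightarrow> qpoch a q n * qpoch_inf (a * q ^ n) q"
    using tendsto_mult_left[OF lim] by simp
  moreover have "(\<lambda>N. qpoch a q (N + n)) \<longlonglongrightarrow> qpoch_inf a q"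
    using lim by (rule LIMSEQ_ignore_initial_segment)
  ultimately show ?thesis
    by (rule LIMSEQ_unique)
qed

text \<open>The multi-parameter symbol: \<open>qpochs [a\<^sub>1, \<dots>, a\<^sub>m] q n\<close> is \<open>(a\<^sub>1, \<dots>, a\<^sub>m; q)\<^sub>n\<close>.\<close>

definition qpochs :: "complex list \<Rightarrow> complex \<Rightarrow> nat \<Rightarrow> complex" where
  "qpochs cs q n = (\<Prod>c\<leftarrow>cs. qpoch c q n)"

definition qtau :: "complex \<Rightarrow> nat \<Rightarrow> complex" where
  "qtau q n = (-1) ^ n * q ^ (n * (n - 1) div 2)"

text \<open>The general term and the sum of the basic hypergeometric series
  \<open>\<^sub>r\<phi>\<^sub>s\<close> with upper parameters \<open>as\<close> (\<open>r = length as\<close>) and lower parameters \<open>bs\<close>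
  (\<open>s = length bs\<close>). The exponent \<open>s + 1 - r\<close> is an integer and may be negative.\<close>

definition qhyp_term :: "complex list \<Rightarrow> complex list \<Rightarrow> complex \<Rightarrow> complex \<Rightarrow> nat \<Rightarrow> complex" where
  "qhyp_term as bs q x n =
     qpochs as q n / qpochs bs q n
       * qtau q n powi (int (length bs) + 1 - int (length as))
       * (x ^ n / qpoch q q n)"

definition qhyp :: "complex list \<Rightarrow> complex list \<Rightarrow> complex \<Rightarrow> complex \<Rightarrow> complex" where
  "qhyp as bs q x = (\<Sum>n. qhyp_term as bs q x n)"

end

theory Submission
  imports Defs
begin

text \<open>All three identities come from comparing coefficients, the left-hand side being a double series over
  \<open>(N, M)\<close> and the right-hand side a triple series over \<open>(k, n, m)\<close>.

  Reflecting the shifted factorials shows that all factors involving \<open>a\<^sub>1, \<dots>, a\<^bsub>r+1\<^esub>\<close>, \<open>b\<^sub>1, \<dots>, b\<^sub>r\<close> and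
  \<open>y\<close> combine into a weight \<open>W(n, m)\<close> that is \<open>x\<^sup>n\<close> times a function of \<open>m - n\<close>
  (\<open>bilateral_weight_Suc_Suc\<close>). The substitution \<open>(N, M) = (n + k, m + k)\<close> preserves \<open>m - n\<close>, and
  \<open>x\<^sup>k W(n, m) = W(N, M)\<close>. Thus the weight drops out, and one has to show that, for each \<open>(N, M)\<close>, the remaining
  left-hand factor is the sum over \<open>k \<le> min N M\<close> of the remaining right-hand factors at
  \<open>(k, N - k, M - k)\<close> (\<open>kernel_convolution\<close>). This finite identity is the q-Saalschuetz sum; absolute
  convergence permits the regrouping (\<open>infsum_kernel\<close>).

  The two special cases are not obtained by taking limits of series. Instead, the q-Saalschuetz
  sum is proved with \<open>t\<close> and \<open>b\<close> replaced by the homogeneous coordinates \<open>s : u\<close> and \<open>b : c\<close>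
  (\<open>homogeneous_q_saalschuetz\<close>). It is a polynomial identity in these, so the points at infinity \<open>u = 0\<close> and
  \<open>c = 0\<close> are as good as any others. There the sum over \<open>k\<close> becomes Euler's expansion of
  \<open>(xq\<^sup>n; q)\<^sub>\<infinity>\<close> (\<open>euler_qpoch_inf\<close>), which produces the quotient \<open>(x; q)\<^sub>\<infinity> / (x; q)\<^sub>n\<close>.\<close>

section \<open>Homogeneous shifted factorials\<close>

text \<open>The homogeneous form \<open>u\<^sup>n (s/u; q)\<^sub>n\<close> of the shifted factorial. It is a polynomial in \<open>u\<close> and
  \<open>s\<close>, so that the value \<open>u = 0\<close> is available: it takes the place of the limit in which the parameter
  \<open>s/u\<close> tends to infinity.\<close>

definition hpoch :: "complex \<Rightarrow> complex \<Rightarrow> complex \<Rightarrow> nat \<Rightarrow> complex" where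
  "hpoch u s q n = (\<Prod>k<n. u - s * q ^ k)"

lemma hpoch_0 [simp]: "hpoch u s q 0 = 1"
  by (simp add: hpoch_def)

lemma hpoch_Suc: "hpoch u s q (Suc n) = hpoch u s q n * (u - s * q ^ n)"
  by (simp add: hpoch_def)

lemma hpoch_Suc_shift: "hpoch u s q (Suc n) = (u - s) * hpoch u (s * q) q n"
  unfolding hpoch_def by (subst prod.lessThan_Suc_shift) (simp add: mult_ac)

lemma hpoch_add: "hpoch u s q (m + n) = hpoch u s q m * hpoch u (s * q ^ m) q n"
  by (induction n) (simp_all add: hpoch_Suc power_add mult_ac)

lemma hpoch_one: "hpoch 1 s q n = qpoch s q n"
  by (simp add: hpoch_def qpoch_def)

lemma qtau_0 [simp]: "qtau q 0 = 1"
  by (simp add: qtau_def)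

lemma qtau_Suc: "qtau q (Suc n) = - (q ^ n) * qtau q n"
proof -
  have "Suc n * (Suc n - 1) div 2 = n * (n - 1) div 2 + n"
    by (cases n) auto
  then show ?thesis
    by (simp add: qtau_def power_add)
qed

lemma hpoch_zero_left: "hpoch 0 s q n = s ^ n * qtau q n"
  by (induction n) (simp_all add: hpoch_Suc qtau_Suc)

section \<open>A homogeneous q-Saalschuetz sum\<close>

lemma power_neq_one:
  fixes q :: complex
  assumes "norm q < 1" "n > 0"
  shows "q ^ n \<noteq> 1"
proof
  assume "q ^ n = 1"
  then have "norm q ^ n = 1"
    by (metis norm_one norm_power)
  with assms show False
    by (metis less_irrefl norm_ge_zero power_less_one_iff)
qed

lemma qpoch_q_nonzero:
  assumes "norm q < 1"
  shows "qpoch q q n \<noteq> 0"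
  using power_neq_one[OF assms, of "Suc _"] by (auto simp: qpoch_def)

lemma qpoch_Suc: "qpoch a q (Suc n) = qpoch a q n * (1 - a * q ^ n)"
  by (simp add: qpoch_def)

lemma qpoch_q_Suc: "qpoch q q (Suc n) = qpoch q q n * (1 - q * q ^ n)"
  by (simp add: qpoch_Suc)

text \<open>With \<open>c = u = 1\<close>, division by \<open>(zq, b s; q)\<^sub>N\<close> turns these, up to the factor \<open>\<tau>(N) / (q; q)\<^sub>N\<close>, into
  the terms of the balanced \<open>\<^sub>3\<phi>\<^sub>2\<close> at \<open>q\<close> with upper parameters \<open>q\<^sup>-\<^sup>N\<close>, \<open>b\<close>, \<open>s z q\<^sup>N\<close> and lower
  parameters \<open>b s\<close>, \<open>z q\<close>. In the present form \<open>z\<close> and the pairs \<open>(c, b)\<close>, \<open>(u, s)\<close> occur only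
  polynomially. This matters because \<open>z\<close> will be an
  integral power of \<open>q\<close>, and \<open>(zq; q)\<^sub>n\<close> vanishes for large \<open>n\<close> if that power is negative.\<close>

definition saalschuetz_term where
  "saalschuetz_term q u s b c z N n =
     qtau q (N - n) / (qpoch q q (N - n) * qpoch q q n)
       * hpoch c b q n * hpoch u (s * z * q ^ N) q n
       * hpoch 1 (z * q ^ Suc n) q (N - n) * hpoch (c * u) (b * s * q ^ n) q (N - n)"

text \<open>The quotient of consecutive values of the closed form in \<open>homogeneous_q_saalschuetz\<close> below.\<close>

definition saalschuetz_ratio where
  "saalschuetz_ratio q u s b c z N = - (q ^ N) * (u - s * q ^ N) * (b - c * z * q ^ Suc N) / (1 - q ^ Suc N)"

text \<open>The partner of the terms in the sense of Wilf and Zeilberger, for \<open>N = p + i\<close>: it is the partial sum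
  over \<open>n \<le> p\<close> of the term for \<open>N + 1\<close> minus \<open>saalschuetz_ratio\<close> times the term for \<open>N\<close>. Writing
  \<open>N - p\<close> as \<open>i\<close> avoids truncated subtraction.\<close>

definition saalschuetz_certificate where
  "saalschuetz_certificate q u s b c z p i = - (q ^ i) / (1 - q ^ Suc (p + i)) * qtau q i / (qpoch q q p * qpoch q q i)
       * hpoch c b q (Suc p) * hpoch u (s * z * q ^ Suc (p + i)) q p * (u - s * z * q ^ Suc (p + i) * q ^ (p + i))
       * hpoch 1 (z * q ^ Suc p) q i * hpoch (c * u) (b * s * q ^ p) q i"

text \<open>What remains of the telescoping relation after the common factors are removed, with
  \<open>Q = q\<^sup>p\<close>, \<open>I = q\<^sup>i\<close> and hence \<open>q\<^sup>N = q (Q I)\<close> for \<open>N = p + 1 + i\<close>.\<close>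

lemma saalschuetz_rational_identity:
  fixes q u s b c z Q I :: complex
  assumes "1 - q * I \<noteq> 0" "1 - q * Q \<noteq> 0" "1 - q * (q * (Q * I)) \<noteq> 0"
  shows "- I * (u - s * z * (q * (q * (Q * I))) * Q) * (1 - z * (q * (q * Q)) * I) * (c * u - b * s * (q * Q) * I)
           / ((1 - q * I) * (1 - q * Q))
         + (q * (Q * I)) * (u - s * (q * (Q * I))) * (b - c * z * (q * (q * (Q * I)))) * (u - s * z * (q * (Q * I)))
           / ((1 - q * (q * (Q * I))) * (1 - q * Q))
       = - I / (1 - q * (q * (Q * I))) * (c - b * (q * Q)) * (u - s * z * (q * (q * (Q * I))) * Q)
            * (u - s * z * (q * (q * (Q * I)) * (q * (Q * I)))) / (1 - q * Q)
         - I * I * q / (1 - q * (q * (Q * I))) * (u - s * z * (q * (q * (Q * I)) * (q * (Q * I))))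
            * (1 - z * (q * Q)) * (c * u - b * s * Q) / (1 - q * I)"
  using assms by (simp add: divide_simps) algebra

lemma saalschuetz_certificate_step:
  fixes q :: complex
  assumes "norm q < 1"
  defines "N \<equiv> \<lambda>p i. Suc (p + i)"
  shows "saalschuetz_term q u s b c z (Suc (N p i)) (Suc p)
           - saalschuetz_ratio q u s b c z (N p i) * saalschuetz_term q u s b c z (N p i) (Suc p)
         = saalschuetz_certificate q u s b c z (Suc p) i - saalschuetz_certificate q u s b c z p (Suc i)"
proof -
  define Q I where "Q = q ^ p" and "I = q ^ i"
  have nz: "1 - q * I \<noteq> 0" "1 - q * Q \<noteq> 0" "1 - q * (q * (Q * I)) \<noteq> 0"
    using power_neq_one[OF assms(1), of "Suc i"] power_neq_one[OF assms(1), of "Suc p"]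
      power_neq_one[OF assms(1), of "Suc (Suc (p + i))"]
    by (auto simp: Q_def I_def power_add)
  have nzq: "qpoch q q p \<noteq> 0" "qpoch q q i \<noteq> 0"
    using qpoch_q_nonzero[OF assms(1)] by auto
  \<comment> \<open>the part common to all four terms of the relation\<close>
  define D where "D = qtau q i / (qpoch q q p * qpoch q q i) * hpoch c b q (Suc p)
     * hpoch u (s * z * (q * (q * (Q * I)))) q p * hpoch 1 (z * (q * (q * Q))) q i
     * hpoch (c * u) (b * s * (q * Q)) q i"
  have 1: "saalschuetz_term q u s b c z (Suc (N p i)) (Suc p)
     = D * (- I * (u - s * z * (q * (q * (Q * I))) * Q) * (1 - z * (q * (q * Q)) * I) * (c * u - b * s * (q * Q) * I)
           / ((1 - q * I) * (1 - q * Q)))"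
  proof -
    have e: "Suc (N p i) - Suc p = Suc i" by (simp add: N_def)
    show ?thesis
      unfolding saalschuetz_term_def e D_def
      by (simp add: qpoch_q_Suc qtau_Suc hpoch_Suc[of u] hpoch_Suc[of 1] hpoch_Suc[of "c*u"] N_def power_add mult_ac flip: Q_def I_def)
  qed
  have 2: "saalschuetz_ratio q u s b c z (N p i) * saalschuetz_term q u s b c z (N p i) (Suc p)
     = - D * ((q * (Q * I)) * (u - s * (q * (Q * I))) * (b - c * z * (q * (q * (Q * I)))) * (u - s * z * (q * (Q * I)))
           / ((1 - q * (q * (Q * I))) * (1 - q * Q)))"
  proof -
    have e: "N p i - Suc p = i" by (simp add: N_def)
    have h: "hpoch u (s * z * q ^ N p i) q (Suc p) = (u - s * z * (q * (Q * I))) * hpoch u (s * z * (q * (q * (Q * I)))) q p"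
      by (subst hpoch_Suc_shift) (simp add: N_def power_add Q_def I_def mult_ac)
    show ?thesis
      unfolding saalschuetz_term_def saalschuetz_ratio_def e D_def h
      by (simp add: qpoch_q_Suc N_def power_add mult_ac flip: Q_def I_def)
  qed
  have 3: "saalschuetz_certificate q u s b c z (Suc p) i
     = D * (- I / (1 - q * (q * (Q * I))) * (c - b * (q * Q)) * (u - s * z * (q * (q * (Q * I))) * Q)
            * (u - s * z * (q * (q * (Q * I)) * (q * (Q * I)))) / (1 - q * Q))"
    unfolding saalschuetz_certificate_def D_def
    by (simp add: qpoch_q_Suc hpoch_Suc[of c b q "Suc p"] hpoch_Suc[of u] power_add mult_ac flip: Q_def I_def)
  have 4: "saalschuetz_certificate q u s b c z p (Suc i)
     = D * (I * I * q / (1 - q * (q * (Q * I))) * (u - s * z * (q * (q * (Q * I)) * (q * (Q * I))))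
            * (1 - z * (q * Q)) * (c * u - b * s * Q) / (1 - q * I))"
  proof -
    have h1: "hpoch 1 (z * q ^ Suc p) q (Suc i) = (1 - z * (q * Q)) * hpoch 1 (z * (q * (q * Q))) q i"
      by (subst hpoch_Suc_shift) (simp add: Q_def mult_ac)
    have h2: "hpoch (c * u) (b * s * q ^ p) q (Suc i) = (c * u - b * s * Q) * hpoch (c * u) (b * s * (q * Q)) q i"
      by (subst hpoch_Suc_shift) (simp add: Q_def mult_ac)
    show ?thesis
      unfolding saalschuetz_certificate_def D_def h1 h2
      by (simp add: qpoch_q_Suc qtau_Suc power_add mult_ac flip: Q_def I_def)
  qed
  show ?thesis
    unfolding 1 2 3 4 using arg_cong[OF saalschuetz_rational_identity[OF nz, of u s z c b], of "\<lambda>X. D * X"]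
    by (simp only: distrib_left right_diff_distrib) simp
qed

lemma saalschuetz_partial_sum:
  fixes q :: complex
  assumes "norm q < 1" "p \<le> N"
  shows "(\<Sum>n\<le>p. saalschuetz_term q u s b c z (Suc N) n - saalschuetz_ratio q u s b c z N * saalschuetz_term q u s b c z N n)
         = saalschuetz_certificate q u s b c z p (N - p)"
  using assms(2)
proof (induction p)
  case 0
  have "q ^ Suc N \<noteq> 1" using power_neq_one[OF assms(1)] by blast
  then have nz: "1 - q * q ^ N \<noteq> 0" by simp
  show ?case
    using nz qpoch_q_nonzero[OF assms(1), of N]
    by (simp add: saalschuetz_term_def saalschuetz_ratio_def saalschuetz_certificate_def qpoch_q_Suc qtau_Suc hpoch_Suc power_add qpoch_def[of _ _ 0])
      (simp add: divide_simps, algebra)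
next
  case (Suc p)
  then obtain i where N: "N = Suc (p + i)"
    by (auto simp: Suc_le_eq less_iff_Suc_add)
  have "(\<Sum>n\<le>p. saalschuetz_term q u s b c z (Suc N) n - saalschuetz_ratio q u s b c z N * saalschuetz_term q u s b c z N n)
         = saalschuetz_certificate q u s b c z p (Suc i)"
    using Suc by (simp add: N Suc_diff_le)
  then show ?case
    using saalschuetz_certificate_step[OF assms(1), of u s b c z p i] by (simp add: N)
qed

text \<open>By telescoping, the sum for \<open>N + 1\<close> is \<open>saalschuetz_ratio\<close> times the sum for \<open>N\<close>: the partial sum
  over \<open>n \<le> N\<close>, which is the certificate at \<open>p = N\<close>, is cancelled by the one further term \<open>n = N + 1\<close>.\<close>

theorem homogeneous_q_saalschuetz:
  assumes "norm q < 1"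
  shows "(\<Sum>n\<le>N. saalschuetz_term q u s b c z N n) = qtau q N / qpoch q q N * hpoch u s q N * hpoch b (c * z * q) q N"
proof (induction N)
  case 0
  then show ?case by (simp add: saalschuetz_term_def qpoch_def)
next
  case (Suc N)
  have nz: "1 - q * q ^ N \<noteq> 0" using power_neq_one[OF assms, of "Suc N"] by simp
  have "saalschuetz_certificate q u s b c z N 0
      = - (1 / (1 - q * q ^ N) / qpoch q q N * hpoch c b q (Suc N) * hpoch u (s * z * q ^ Suc N) q (Suc N))"
    by (simp add: saalschuetz_certificate_def hpoch_Suc[of u] power_add qpoch_def[of _ _ 0] mult_ac)
  then have "saalschuetz_certificate q u s b c z N 0 + saalschuetz_term q u s b c z (Suc N) (Suc N) = 0"
    by (simp add: saalschuetz_term_def qpoch_q_Suc qpoch_def[of _ _ 0] mult_ac)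
  then have "(\<Sum>n\<le>Suc N. saalschuetz_term q u s b c z (Suc N) n)
      = saalschuetz_ratio q u s b c z N * (\<Sum>n\<le>N. saalschuetz_term q u s b c z N n)"
    using saalschuetz_partial_sum[OF assms order.refl, of u s b c z N]
    by (simp add: sum_subtractf sum_distrib_left algebra_simps)
  then show ?case
    unfolding Suc.IH by (simp add: saalschuetz_ratio_def qtau_Suc qpoch_q_Suc hpoch_Suc mult_ac)
qed

section \<open>The kernel identity and summation along diagonals\<close>

text \<open>The factors of the left-hand double series that remain once \<open>bilateral_weight\<close> (below) is split off.\<close>

definition collected_kernel where
  "collected_kernel q u s b c n m =
     qtau q n * hpoch u s q n * hpoch b (c * q powi (int m - int n + 1)) q n
       / (qpoch q q n * hpoch (c * u) (b * s) q n * qpoch q q m)"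

text \<open>The same for the right-hand triple series.\<close>

definition expanded_kernel where
  "expanded_kernel q u s b c k n m =
     qtau q k * hpoch c b q n * hpoch u (s * q ^ (k + m)) q n
       / (qpoch q q k * qpoch q q n * hpoch (c * u) (b * s) q n * qpoch q q m)"

lemma hpoch_eq_0I: "i < n \<Longrightarrow> u = s * q ^ i \<Longrightarrow> hpoch u s q n = 0"
  by (auto simp: hpoch_def prod_zero_iff)

text \<open>This is the homogeneous q-Saalschuetz sum with \<open>z = q\<^bsup>M-N\<^esup>\<close>, read backwards by \<open>n = N - k\<close>. The
  factor \<open>(zq\<^bsup>n+1\<^esup>; q)\<^sub>k\<close> is \<open>(q; q)\<^sub>M / (q; q)\<^bsub>M-k\<^esub>\<close> when \<open>k \<le> M\<close> and contains the
  factor \<open>1 - q\<^sup>0\<close> when \<open>k > M\<close>; this cuts the sum down to \<open>k \<le> min N M\<close>, also when \<open>M < N\<close>.\<close>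

lemma kernel_convolution:
  fixes q :: complex
  assumes "0 < norm q" "norm q < 1" "hpoch (c * u) (b * s) q N \<noteq> 0"
  shows "collected_kernel q u s b c N M = (\<Sum>k\<le>min N M. expanded_kernel q u s b c k (N - k) (M - k))"
proof -
  have q0: "q \<noteq> 0" using assms(1) by auto
  define z where "z = q powi (int M - int N)"
  have zN: "z * q ^ N = q ^ M"
    using q0 by (simp add: z_def power_int_diff)
  have nzq: "qpoch q q n \<noteq> 0" for n
    using qpoch_q_nonzero[OF assms(2)] .
  let ?H = "hpoch (c * u) (b * s) q"
  have main: "saalschuetz_term q u s b c z N (N - k)
      = (if k \<le> M then qpoch q q M * ?H N * expanded_kernel q u s b c k (N - k) (M - k) else 0)"
    if k: "k \<le> N" for k
  proof -
    have e: "N - (N - k) = k" using k by simp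
    have kk: "z * q ^ Suc (N - k) * q ^ k = q * q ^ M"
    proof -
      have "z * q ^ Suc (N - k) * q ^ k = q * (z * q ^ (N - k + k))"
        by (simp only: power_add) (simp add: mult_ac)
      then show ?thesis using k zN by simp
    qed
    show ?thesis
    proof (cases "k \<le> M")
      case True
      have "z * q ^ Suc (N - k) * q ^ k = (q * q ^ (M - k)) * q ^ k"
        unfolding kk using True by (simp add: mult.assoc flip: power_add)
      then have zk: "z * q ^ Suc (N - k) = q * q ^ (M - k)"
        using q0 by simp
      have "qpoch q q (M - k) * hpoch 1 (q * q ^ (M - k)) q k = qpoch q q M"
        using hpoch_add[of 1 q q "M - k" k] True by (simp add: hpoch_one)
      then have 1: "hpoch 1 (z * q ^ Suc (N - k)) q k = qpoch q q M / qpoch q q (M - k)"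
        unfolding zk using nzq by (simp add: field_simps)
      have 2: "?H (N - k) * hpoch (c * u) (b * s * q ^ (N - k)) q k = ?H N"
        using hpoch_add[of "c * u" "b * s" q "N - k" k] k by simp
      then have "?H (N - k) \<noteq> 0" using assms(3) by auto
      with 2 have 3: "hpoch (c * u) (b * s * q ^ (N - k)) q k = ?H N / ?H (N - k)"
        by (simp add: field_simps)
      have 4: "s * z * q ^ N = s * q ^ (k + (M - k))" using zN True by simp
      show ?thesis
        using True unfolding saalschuetz_term_def e 1 3 4 expanded_kernel_def by (simp add: mult_ac)
    next
      case False
      have "q ^ (k - Suc M) * q ^ Suc M = q ^ k"
        using False by (subst power_add[symmetric]) simp
      then have "z * q ^ Suc (N - k) * q ^ k = (z * q ^ Suc (N - k) * q ^ (k - Suc M)) * (q * q ^ M)"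
        by (metis mult.assoc power_Suc)
      then have "z * q ^ Suc (N - k) * q ^ (k - Suc M) = 1"
        unfolding kk using q0 by simp
      then have "hpoch 1 (z * q ^ Suc (N - k)) q k = 0"
        using False by (intro hpoch_eq_0I[of "k - Suc M"]) auto
      then show ?thesis
        using False k by (simp add: saalschuetz_term_def)
    qed
  qed
  have "qtau q N / qpoch q q N * hpoch u s q N * hpoch b (c * z * q) q N
        = (\<Sum>n\<le>N. saalschuetz_term q u s b c z N n)"
    using homogeneous_q_saalschuetz[OF assms(2)] by simp
  also have "\<dots> = (\<Sum>k\<le>N. saalschuetz_term q u s b c z N (N - k))"
    by (rule sum.reindex_bij_witness[of _ "\<lambda>k. N - k" "\<lambda>k. N - k"]) auto
  also have "\<dots> = (\<Sum>k\<le>N. if k \<in> {..M} then qpoch q q M * ?H N * expanded_kernel q u s b c k (N - k) (M - k) else 0)"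
    by (intro sum.cong) (simp_all add: main)
  also have "\<dots> = (\<Sum>k\<in>{..N} \<inter> {..M}. qpoch q q M * ?H N * expanded_kernel q u s b c k (N - k) (M - k))"
    by (subst sum.inter_restrict) auto
  also have "{..N} \<inter> {..M} = {..min N M}" by auto
  also have "(\<Sum>k\<le>min N M. qpoch q q M * ?H N * expanded_kernel q u s b c k (N - k) (M - k))
     = qpoch q q M * ?H N * (\<Sum>k\<le>min N M. expanded_kernel q u s b c k (N - k) (M - k))"
    by (simp add: sum_distrib_left)
  finally have "(\<Sum>k\<le>min N M. expanded_kernel q u s b c k (N - k) (M - k))
     = qtau q N / qpoch q q N * hpoch u s q N * hpoch b (c * z * q) q N / (qpoch q q M * ?H N)"
    using nzq[of M] assms(3) by (simp add: field_simps)
  moreover have "q powi (int M - int N + 1) = z * q"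
    using q0 by (simp add: z_def power_int_add)
  ultimately show ?thesis
    by (simp add: collected_kernel_def mult.assoc)
qed

text \<open>The triple series is regrouped by \<open>(N, M) = (n + k, m + k)\<close>. Along such a diagonal \<open>x\<^sup>k W(n, m)\<close>
  has the constant value \<open>W(N, M)\<close>, so that each group is an instance of \<open>kernel_convolution\<close>.\<close>

lemma infsum_kernel:
  fixes W :: "nat \<Rightarrow> nat \<Rightarrow> complex"
  assumes q: "0 < norm q" "norm q < 1"
    and nz: "\<And>n. hpoch (c * u) (b * s) q n \<noteq> 0"
    and W: "\<And>n m. W (Suc n) (Suc m) = x * W n m"
    and sum: "(\<lambda>(k, n, m). norm (expanded_kernel q u s b c k n m * x ^ k * W n m)) summable_on UNIV"
  shows "infsum (\<lambda>(n, m). collected_kernel q u s b c n m * W n m) UNIV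
       = infsum (\<lambda>(k, n, m). expanded_kernel q u s b c k n m * x ^ k * W n m) UNIV"
proof -
  define f where "f = (\<lambda>(k, n, m). expanded_kernel q u s b c k n m * x ^ k * W n m)"
  define S where "S = Sigma UNIV (\<lambda>(N, M). {..min N M :: nat})"
  define g where "g = (\<lambda>((N, M), k). (k, N - k, M - k :: nat))"
  have bij: "bij_betw g S UNIV"
    by (rule bij_betwI[where g = "\<lambda>(k, n, m). ((n + k, m + k), k)"]) (auto simp: g_def S_def)
  have "f summable_on UNIV"
    using abs_summable_summable[of f UNIV] sum by (simp add: f_def case_prod_unfold)
  then have gS: "(\<lambda>p. f (g p)) summable_on S"
    using summable_on_reindex_bij_betw[OF bij] by blast
  have Wk: "x ^ k * W (N - k) (M - k) = W N M" if "k \<le> min N M" for k N M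
    using that
  proof (induction k)
    case (Suc k)
    then have "W (N - k) (M - k) = x * W (N - Suc k) (M - Suc k)"
      using W[of "N - Suc k" "M - Suc k"] by (simp add: Suc_diff_Suc)
    with Suc show ?case by (simp add: mult_ac)
  qed simp
  have "infsum f UNIV = infsum (\<lambda>p. f (g p)) S"
    by (rule infsum_reindex_bij_betw[OF bij, symmetric])
  also have "\<dots> = infsum (\<lambda>P. infsum (\<lambda>k. f (g (P, k))) (case P of (N, M) \<Rightarrow> {..min N M})) UNIV"
    using infsum_Sigma_banach[OF gS[unfolded S_def]] by (simp add: S_def)
  also have "\<dots> = infsum (\<lambda>(n, m). collected_kernel q u s b c n m * W n m) UNIV"
  proof (intro infsum_cong, clarify)
    fix N M
    have "infsum (\<lambda>k. f (g ((N, M), k))) {..min N M}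
        = (\<Sum>k\<le>min N M. expanded_kernel q u s b c k (N - k) (M - k) * W N M)"
      by (subst infsum_finite) (auto simp: f_def g_def mult.assoc Wk intro!: sum.cong)
    also have "\<dots> = collected_kernel q u s b c N M * W N M"
      by (simp add: kernel_convolution[OF q nz] sum_distrib_right)
    finally show "infsum (\<lambda>k. f (g ((N, M), k))) {..min N M} = collected_kernel q u s b c N M * W N M" .
  qed
  finally show ?thesis by (simp add: f_def)
qed

section \<open>Iterated series as unordered sums\<close>

lemma suminf_eq_infsum:
  fixes f :: "nat \<Rightarrow> complex"
  assumes "f summable_on UNIV"
  shows "suminf f = infsum f UNIV"
  using has_sum_imp_sums[OF has_sum_infsum[OF assms]] by (simp add: sums_iff)

lemma suminf_infsum:
  fixes f :: "nat \<Rightarrow> 'a \<Rightarrow> complex"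
  assumes "(\<lambda>(n, p). f n p) summable_on UNIV"
  shows "(\<Sum>n. infsum (f n) UNIV) = infsum (\<lambda>(n, p). f n p) UNIV"
  using infsum_Sigma'_banach[of f UNIV "\<lambda>_. UNIV"] summable_on_Sigma_banach[of f UNIV "\<lambda>_. UNIV"] assms
  by (simp add: suminf_eq_infsum)

lemma abs_summable_section:
  fixes f :: "'b \<Rightarrow> 'a \<Rightarrow> complex"
  assumes "(\<lambda>(n, p). norm (f n p)) summable_on UNIV"
  shows "(\<lambda>p. norm (f n p)) summable_on UNIV"
  using Infinite_Sum.abs_summable_on_Sigma_iff[where f = "\<lambda>(n, p). f n p" and A = UNIV and B = "\<lambda>_. UNIV"] assms
  by (simp add: case_prod_unfold)

text \<open>For \<open>L = 0\<close> nothing is known about the convergence of \<open>g\<close>, but then both sides vanish.\<close>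

lemma suminf_mult_summable_on:
  fixes g :: "nat \<Rightarrow> complex"
  assumes "(\<lambda>m. norm (L * g m)) summable_on UNIV"
  shows "L * (\<Sum>m. g m) = infsum (\<lambda>m. L * g m) UNIV"
proof (cases "L = 0")
  case False
  have "(\<lambda>m. L * g m) summable_on UNIV"
    using assms by (rule abs_summable_summable)
  moreover from this have "g summable_on UNIV"
    using summable_on_cmult_right'[OF False] by blast
  ultimately show ?thesis
    by (simp add: suminf_eq_infsum infsum_cmult_right')
qed simp

lemma suminf_suminf_mult:
  fixes g :: "nat \<Rightarrow> nat \<Rightarrow> complex"
  assumes "(\<lambda>(n, m). norm (L n * g n m)) summable_on UNIV"
  shows "(\<Sum>n. L n * (\<Sum>m. g n m)) = infsum (\<lambda>(n, m). L n * g n m) UNIV"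
proof -
  have "(\<Sum>n. L n * (\<Sum>m. g n m)) = (\<Sum>n. infsum (\<lambda>m. L n * g n m) UNIV)"
    using abs_summable_section[OF assms] by (simp add: suminf_mult_summable_on)
  also have "\<dots> = infsum (\<lambda>(n, m). L n * g n m) UNIV"
    using abs_summable_summable[of "\<lambda>(n, m). L n * g n m" UNIV] assms
    by (intro suminf_infsum) (simp add: case_prod_unfold)
  finally show ?thesis .
qed

lemma suminf_suminf_suminf_mult:
  fixes g :: "nat \<Rightarrow> nat \<Rightarrow> nat \<Rightarrow> complex"
  assumes "(\<lambda>(k, n, m). norm (K k * (L k n * g k n m))) summable_on UNIV"
  shows "(\<Sum>k. K k * (\<Sum>n. L k n * (\<Sum>m. g k n m))) = infsum (\<lambda>(k, n, m). K k * (L k n * g k n m)) UNIV"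
proof -
  let ?f = "\<lambda>k (n, m). K k * (L k n * g k n m)"
  have f: "(\<lambda>(k, p). norm (?f k p)) summable_on UNIV"
    using assms by (simp add: case_prod_unfold)
  have "K k * (\<Sum>n. L k n * (\<Sum>m. g k n m)) = infsum (?f k) UNIV" for k
  proof (cases "K k = 0")
    case False
    have "(\<lambda>p. norm (?f k p)) summable_on UNIV"
      using abs_summable_section[OF f] .
    then have "(\<lambda>p. norm (K k) * norm (case p of (n, m) \<Rightarrow> L k n * g k n m)) summable_on UNIV"
      by (simp add: case_prod_unfold norm_mult)
    then have "(\<lambda>(n, m). norm (L k n * g k n m)) summable_on UNIV"
      using summable_on_cmult_right'[of "norm (K k)" "\<lambda>p. norm (case p of (n, m) \<Rightarrow> L k n * g k n m)"] False
      by (simp add: case_prod_unfold)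
    then show ?thesis
      by (simp add: suminf_suminf_mult case_prod_unfold infsum_cmult_right')
  qed (simp add: case_prod_unfold)
  then have "(\<Sum>k. K k * (\<Sum>n. L k n * (\<Sum>m. g k n m))) = (\<Sum>k. infsum (?f k) UNIV)"
    by simp
  also have "\<dots> = infsum (\<lambda>(k, p). ?f k p) UNIV"
    using abs_summable_summable[of "\<lambda>(k, p). ?f k p" UNIV] f by (intro suminf_infsum) (simp add: case_prod_unfold)
  finally show ?thesis by (simp add: case_prod_unfold)
qed

section \<open>Euler's expansion of the infinite product\<close>

lemma qpoch_tendsto:
  assumes "norm q < 1"
  shows "qpoch a q \<longlonglongrightarrow> qpoch_inf a q"
proof -
  have "summable (\<lambda>k. norm (1 - a * q ^ k - 1))"
    using assms by (simp add: norm_mult norm_power summable_mult summable_geometric)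
  then have "convergent_prod (\<lambda>k. 1 - a * q ^ k)"
    by (intro abs_convergent_prod_imp_convergent_prod summable_imp_abs_convergent_prod)
  from convergent_prod_LIMSEQ[OF this]
  have "(\<lambda>N. qpoch a q (Suc N)) \<longlonglongrightarrow> qpoch_inf a q"
    unfolding qpoch_def qpoch_inf_def lessThan_Suc_atMost .
  then show ?thesis
    by (rule LIMSEQ_imp_Suc)
qed

lemma summable_euler:
  fixes q z :: complex
  assumes "norm q < 1"
  shows "summable (\<lambda>k. norm (qtau q k / qpoch q q k * z ^ k))"
proof -
  have "(\<lambda>k. norm q ^ k * norm z) \<longlonglongrightarrow> 0 * norm z"
    using assms by (intro tendsto_mult_right LIMSEQ_realpow_zero) auto
  then have "eventually (\<lambda>k. norm q ^ k * norm z < (1 - norm q) / 2) sequentially"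
    by (rule order_tendstoD) (use assms in simp)
  then obtain K where K: "\<And>k. k \<ge> K \<Longrightarrow> norm q ^ k * norm z < (1 - norm q) / 2"
    by (auto simp: eventually_at_top_linorder)
  show ?thesis
  proof (rule summable_ratio_test[of "1/2" K])
    fix k assume k: "k \<ge> K"
    have "norm (q * q ^ k) \<le> norm q"
      using assms by (simp add: norm_mult norm_power mult_left_le power_le_one)
    moreover have "1 - norm (q * q ^ k) \<le> norm (1 - q * q ^ k)"
      using norm_triangle_ineq2[of 1 "q * q ^ k"] by simp
    ultimately have d: "1 - norm q \<le> norm (1 - q * q ^ k)" "0 < 1 - norm q"
      using assms by linarith+
    have "norm (qtau q (Suc k) / qpoch q q (Suc k) * z ^ Suc k)
        = (norm q ^ k * norm z / norm (1 - q * q ^ k)) * norm (qtau q k / qpoch q q k * z ^ k)"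
      by (simp add: qtau_Suc qpoch_q_Suc norm_mult norm_divide norm_power mult_ac)
    also have "norm q ^ k * norm z / norm (1 - q * q ^ k) \<le> norm q ^ k * norm z / (1 - norm q)"
      using d by (intro divide_left_mono mult_nonneg_nonneg mult_pos_pos) (auto intro: less_le_trans)
    also have "\<dots> \<le> 1 / 2"
      using K[OF k] d(2) by (simp add: field_simps)
    finally show "norm (norm (qtau q (Suc k) / qpoch q q (Suc k) * z ^ Suc k))
        \<le> 1 / 2 * norm (norm (qtau q k / qpoch q q k * z ^ k))"
      by (simp add: mult_right_mono)
  qed simp
qed

text \<open>The sum \<open>E(z)\<close> of the series satisfies \<open>E(z) = (1 - z) E(zq)\<close>, as comparison of coefficients shows. Iteration gives
  \<open>E(z) = (z; q)\<^sub>n E(zq\<^sup>n)\<close>, and the second factor tends to \<open>E(0) = 1\<close>.\<close>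

theorem euler_qpoch_inf:
  fixes q z :: complex
  assumes "norm q < 1"
  shows "(\<lambda>k. qtau q k / qpoch q q k * z ^ k) sums qpoch_inf z q"
proof -
  define c where "c = (\<lambda>k. qtau q k / qpoch q q k)"
  define E where "E = (\<lambda>z. \<Sum>k. c k * z ^ k)"
  have sm: "summable (\<lambda>k. c k * z ^ k)" for z
    using summable_norm_cancel[OF summable_euler[OF assms]] by (simp add: c_def)
  have rec: "E z = (1 - z) * E (z * q)" for z
  proof -
    have c_Suc: "c (Suc k) * (1 - q ^ Suc k) = - (q ^ k) * c k" for k
      using power_neq_one[OF assms, of "Suc k"] by (simp add: c_def qtau_Suc qpoch_q_Suc)
    have "E z - E (z * q) = (\<Sum>k. c k * (1 - q ^ k) * z ^ k)"
      unfolding E_def by (subst suminf_diff[OF sm sm]) (simp add: algebra_simps)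
    also have "\<dots> = (\<Sum>k. c (Suc k) * (1 - q ^ Suc k) * z ^ Suc k)"
    proof -
      have "summable (\<lambda>k. c k * (1 - q ^ k) * z ^ k)"
        using summable_diff[OF sm[of z] sm[of "z * q"]] by (simp add: algebra_simps)
      from suminf_split_head[OF this] show ?thesis by simp
    qed
    also have "\<dots> = (\<Sum>k. - z * (c k * (z * q) ^ k))"
      unfolding c_Suc by (simp add: power_mult_distrib mult_ac)
    also have "\<dots> = - z * E (z * q)"
      unfolding E_def by (rule suminf_mult[OF sm])
    finally show ?thesis by (simp add: algebra_simps)
  qed
  have iter: "E z = qpoch z q n * E (z * q ^ n)" for n
  proof (induction n)
    case (Suc n)
    then show ?case
      using rec[of "z * q ^ n"] by (simp add: qpoch_Suc mult_ac)
  qed (simp add: qpoch_def)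
  have "isCont E 0"
    unfolding E_def by (rule isCont_powser_converges_everywhere[OF sm])
  moreover have "(\<lambda>n. z * q ^ n) \<longlonglongrightarrow> 0"
    using tendsto_mult_right_zero[OF LIMSEQ_power_zero[OF assms]] .
  ultimately have "(\<lambda>n. E (z * q ^ n)) \<longlonglongrightarrow> E 0"
    by (rule isCont_tendsto_compose)
  then have "(\<lambda>n. qpoch z q n * E (z * q ^ n)) \<longlonglongrightarrow> qpoch_inf z q * E 0"
    by (intro tendsto_mult qpoch_tendsto assms)
  moreover have "E 0 = 1"
    unfolding E_def using powser_zero[of c] by (simp add: c_def qpoch_def)
  ultimately have "E z = qpoch_inf z q"
    unfolding iter[symmetric] by (simp add: LIMSEQ_const_iff)
  then show ?thesis
    using summable_sums[OF sm[of z]] by (simp add: E_def c_def)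
qed

text \<open>Expanding \<open>(x; q)\<^sub>\<infinity> / (x; q)\<^sub>n = (xq\<^sup>n; q)\<^sub>\<infinity>\<close> by Euler's formula turns a double series into a triple
  one. Absolute convergence survives: \<open>(x; q)\<^sub>n\<close> is bounded in \<open>n\<close>, so that \<open>V\<close> itself is absolutely summable,
  and \<open>\<bar>q\<^sup>n\<bar> \<le> 1\<close> bounds the new factor by a summable function of \<open>k\<close> alone.\<close>

lemma
  fixes V :: "nat \<Rightarrow> nat \<Rightarrow> complex"
  assumes q: "norm q < 1"
    and x: "\<And>n. qpoch x q n \<noteq> 0"
    and V: "(\<lambda>(n, m). norm (V n m / qpoch x q n)) summable_on UNIV"
  defines "T \<equiv> \<lambda>k n m. qtau q k / qpoch q q k * (x * q ^ n) ^ k * V n m"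
  shows euler_expansion_summable: "(\<lambda>(k, n, m). norm (T k n m)) summable_on UNIV"
    and euler_expansion_infsum: "infsum (\<lambda>(k, n, m). T k n m) UNIV
           = qpoch_inf x q * infsum (\<lambda>(n, m). V n m / qpoch x q n) UNIV"
proof -
  have "Bseq (qpoch x q)"
    using qpoch_tendsto[OF q] convergent_imp_Bseq convergentI by blast
  then obtain B where B: "\<And>n. norm (qpoch x q n) \<le> B"
    by (auto simp: Bseq_def)
  have V': "(\<lambda>p. norm (case p of (n, m) \<Rightarrow> V n m)) summable_on UNIV"
  proof (rule summable_on_comparison_test)
    show "(\<lambda>p. B * (case p of (n, m) \<Rightarrow> norm (V n m / qpoch x q n))) summable_on UNIV"
      using V by (rule summable_on_cmult_right)
    show "norm (case p of (n, m) \<Rightarrow> V n m) \<le> B * (case p of (n, m) \<Rightarrow> norm (V n m / qpoch x q n))" for p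
    proof (cases p)
      case (Pair n m)
      have "norm (V n m) = norm (qpoch x q n) * norm (V n m / qpoch x q n)"
        using x[of n] by (simp add: norm_divide)
      also have "\<dots> \<le> B * norm (V n m / qpoch x q n)"
        by (intro mult_right_mono B) simp
      finally show ?thesis by (simp add: Pair)
    qed
  qed simp
  define e where "e = (\<lambda>k. norm (qtau q k / qpoch q q k * x ^ k))"
  have "e summable_on UNIV"
    using summable_euler[OF q] by (intro summable_nonneg_imp_summable_on) (simp_all add: e_def)
  then have "(\<lambda>(k, p). e k * norm (case p of (n, m) \<Rightarrow> V n m)) summable_on UNIV \<times> UNIV"
  proof (intro summable_on_SigmaI)
    show "((\<lambda>p. case (k, p) of (k, p) \<Rightarrow> e k * norm (case p of (n, m) \<Rightarrow> V n m)) has_sum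
        e k * infsum (\<lambda>p. norm (case p of (n, m) \<Rightarrow> V n m)) UNIV) UNIV" for k
      unfolding prod.case by (intro has_sum_cmult_right has_sum_infsum V')
  qed (auto simp: e_def intro: summable_on_cmult_left)
  then have "(\<lambda>(k, n, m). e k * norm (V n m)) summable_on UNIV"
    by (simp add: case_prod_unfold)
  then show summ: "(\<lambda>(k, n, m). norm (T k n m)) summable_on UNIV"
  proof (rule summable_on_comparison_test)
    have "norm (T k n m) \<le> e k * norm (V n m)" for k n m
    proof -
      have "norm (T k n m) = e k * norm (V n m) * norm q ^ (n * k)"
        by (simp add: T_def e_def norm_mult norm_divide norm_power power_mult_distrib power_mult)
      also have "\<dots> \<le> e k * norm (V n m)"
        using q by (intro mult_left_le power_le_one) (auto simp: e_def)
      finally show ?thesis .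
    qed
    then show "(case p of (k, n, m) \<Rightarrow> norm (T k n m)) \<le> (case p of (k, n, m) \<Rightarrow> e k * norm (V n m))" for p
      by (simp add: case_prod_unfold)
  qed auto
  have "(\<lambda>(k, p). case p of (n, m) \<Rightarrow> T k n m) summable_on UNIV \<times> UNIV"
    using abs_summable_summable[of "\<lambda>(k, p). case p of (n, m) \<Rightarrow> T k n m" UNIV] summ
    by (simp add: case_prod_unfold)
  then have "infsum (\<lambda>(k, n, m). T k n m) UNIV
       = infsum (\<lambda>p. infsum (\<lambda>k. case p of (n, m) \<Rightarrow> T k n m) UNIV) UNIV"
    using infsum_Sigma'_banach[of "\<lambda>k p. case p of (n, m) \<Rightarrow> T k n m" UNIV "\<lambda>_. UNIV"]
      infsum_swap_banach[of "\<lambda>k p. case p of (n, m) \<Rightarrow> T k n m" UNIV UNIV]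
    by (simp add: case_prod_unfold)
  also have "\<dots> = infsum (\<lambda>p. qpoch_inf x q * (case p of (n, m) \<Rightarrow> V n m / qpoch x q n)) UNIV"
  proof (intro infsum_cong, clarify)
    fix n m
    have "(\<lambda>k. qtau q k / qpoch q q k * (x * q ^ n) ^ k) summable_on UNIV"
      by (rule norm_summable_imp_summable_on[OF summable_euler[OF q]])
    then have "infsum (\<lambda>k. qtau q k / qpoch q q k * (x * q ^ n) ^ k) UNIV = qpoch_inf (x * q ^ n) q"
      using sums_unique[OF euler_qpoch_inf[OF q, of "x * q ^ n"]] by (simp add: suminf_eq_infsum)
    then have "infsum (\<lambda>k. T k n m) UNIV = qpoch_inf (x * q ^ n) q * V n m"
      unfolding T_def by (subst infsum_cmult_left') simp
    also have "\<dots> = qpoch_inf x q * (V n m / qpoch x q n)"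
      using x[of n] by (simp flip: qpoch_mult_qpoch_inf[OF q, of x n])
    finally show "infsum (\<lambda>k. T k n m) UNIV = qpoch_inf x q * (V n m / qpoch x q n)" .
  qed
  also have "\<dots> = qpoch_inf x q * infsum (\<lambda>(n, m). V n m / qpoch x q n) UNIV"
    by (simp add: infsum_cmult_right')
  finally show "infsum (\<lambda>(k, n, m). T k n m) UNIV
           = qpoch_inf x q * infsum (\<lambda>(n, m). V n m / qpoch x q n) UNIV" .
qed

section \<open>The weight common to both sides\<close>

lemma qpochs_Nil [simp]: "qpochs [] q n = 1"
  by (simp add: qpochs_def)

lemma qpochs_Cons [simp]: "qpochs (c # cs) q n = qpoch c q n * qpochs cs q n"
  by (simp add: qpochs_def)

lemma qpochs_append [simp]: "qpochs (cs @ ds) q n = qpochs cs q n * qpochs ds q n"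
  by (simp add: qpochs_def)

lemma qpochs_nonzero: "\<forall>c\<in>set cs. qpoch c q n \<noteq> 0 \<Longrightarrow> qpochs cs q n \<noteq> 0"
  by (induction cs) auto

lemma qhyp_term_balanced:
  assumes "length as = Suc (length bs)"
  shows "qhyp_term as bs q x n = qpochs as q n / qpochs bs q n * (x ^ n / qpoch q q n)"
  using assms by (simp add: qhyp_term_def)

lemma qpoch_Suc_shift: "qpoch a q (Suc n) = (1 - a) * qpoch (a * q) q n"
  using hpoch_Suc_shift[of 1 a q n] by (simp add: hpoch_one)

lemma qpoch_mult_shift: "qpoch a q n * qpoch (a * q ^ n) q m = qpoch a q m * qpoch (a * q ^ m) q n"
  using hpoch_add[of 1 a q n m] hpoch_add[of 1 a q m n] by (simp add: hpoch_one add.commute)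

text \<open>Since \<open>(cq\<^sup>-\<^sup>n; q)\<^sub>m = (cq\<^sup>-\<^sup>n; q)\<^sub>n (c; q)\<^bsub>m-n\<^esub>\<close> and \<open>(cq\<^sup>-\<^sup>n; q)\<^sub>n\<close> is a monomial multiple of
  \<open>(q/c; q)\<^sub>n\<close>, the quotient \<open>(cq\<^sup>-\<^sup>n; q)\<^sub>m / (q/c; q)\<^sub>n\<close> depends on \<open>m - n\<close> alone up to a monomial. A diagonal
  step therefore multiplies it by the explicit factor \<open>-c / q\<^bsup>n+1\<^esup>\<close>. The relation is written without
  division, as the same one serves the \<open>a\<^sub>i\<close>, where \<open>(q/c; q)\<^sub>n\<close> is known not to vanish, and the \<open>b\<^sub>i\<close>,
  where \<open>(cq\<^sup>-\<^sup>n; q)\<^sub>m\<close> is.\<close>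

lemma qpochs_diagonal_shift:
  fixes q :: complex
  assumes "q \<noteq> 0" "\<forall>c\<in>set cs. c \<noteq> 0"
  shows "qpochs (map (\<lambda>c. c * q powi (- int (Suc n))) cs) q (Suc m) * qpochs (map (\<lambda>c. q / c) cs) q n
           * (- (q ^ Suc n)) ^ length cs
       = qpochs (map (\<lambda>c. c * q powi (- int n)) cs) q m * qpochs (map (\<lambda>c. q / c) cs) q (Suc n) * prod_list cs"
  using assms(2)
proof (induction cs)
  case (Cons c cs)
  then have c: "c \<noteq> 0" by simp
  define A where "A = c * q powi (- int (Suc n))"
  have A: "A * q ^ Suc n = c" "A * q = c * q powi (- int n)"
    unfolding A_def power_int_minus power_int_of_nat using assms(1) by (simp_all add: field_simps)
  have "qpoch A q (Suc m) * qpoch (q / c) q n * - (q ^ Suc n)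
      = (1 - A) * qpoch (A * q) q m * qpoch (q / c) q n * - (q ^ Suc n)"
    by (simp add: qpoch_Suc_shift)
  also have "\<dots> = qpoch (A * q) q m * qpoch (q / c) q n * (A * q ^ Suc n - q ^ Suc n)"
    by (simp add: algebra_simps)
  also have "A * q ^ Suc n - q ^ Suc n = (1 - q / c * q ^ n) * c"
    unfolding A using c by (simp add: field_simps)
  also have "qpoch (A * q) q m * qpoch (q / c) q n * \<dots> = qpoch (A * q) q m * qpoch (q / c) q (Suc n) * c"
    by (simp add: qpoch_Suc)
  finally have head: "qpoch A q (Suc m) * qpoch (q / c) q n * - (q ^ Suc n)
    = qpoch (c * q powi (- int n)) q m * qpoch (q / c) q (Suc n) * c"
    by (simp only: A)
  have tail: "qpochs (map (\<lambda>c. c * q powi (- int (Suc n))) cs) q (Suc m) * qpochs (map (\<lambda>c. q / c) cs) q n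
           * (- (q ^ Suc n)) ^ length cs
       = qpochs (map (\<lambda>c. c * q powi (- int n)) cs) q m * qpochs (map (\<lambda>c. q / c) cs) q (Suc n) * prod_list cs"
    using Cons by simp
  show ?case
    using arg_cong2[OF head tail, of "(*)"]
    by (simp only: list.map qpochs_Cons prod_list.Cons list.size power_Suc add_Suc_right add_0_right A_def mult_ac)
qed simp

text \<open>In the notation of bilateral series, with \<open>(c; q)\<^sub>j\<close> for all integers \<open>j\<close>, this is
  \<open>x\<^sup>n y\<^bsup>m-n\<^esup>\<close> times the quotient of all \<open>(a\<^sub>i; q)\<^bsub>m-n\<^esub>\<close> by all \<open>(b\<^sub>i; q)\<^bsub>m-n\<^esub>\<close>. The unreduced form below is the one
  found in the series.\<close>

definition bilateral_weight where
  "bilateral_weight as bs q x y n m =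
     (x * q * prod_list bs / (y * prod_list as)) ^ n * qtau q n
       * (qpochs (map (\<lambda>\<beta>. q / \<beta>) bs) q n / qpochs (map (\<lambda>a. q / a) as) q n)
       * (qpochs (map (\<lambda>a. a * q powi (- int n)) as) q m / qpochs (map (\<lambda>\<beta>. \<beta> * q powi (- int n)) bs) q m)
       * y ^ m"

text \<open>There is one more \<open>a\<^sub>i\<close> than \<open>b\<^sub>i\<close>; the surplus factor \<open>-q\<^bsup>n+1\<^esup>\<close> in the denominator cancels
  the factor \<open>-q\<^sup>n\<close> from \<open>\<tau>\<close> together with the \<open>q\<close> in the base of the power.\<close>

lemma bilateral_weight_Suc_Suc:
  fixes q x y :: complex and as bs :: "complex list"
  assumes "q \<noteq> 0" "y \<noteq> 0" and len: "length as = Suc (length bs)"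
    and as0: "\<forall>a\<in>set as. a \<noteq> 0" and bs0: "\<forall>\<beta>\<in>set bs. \<beta> \<noteq> 0"
    and as: "\<forall>a\<in>set as. \<forall>n. qpoch (q / a) q n \<noteq> 0"
    and bs: "\<forall>\<beta>\<in>set bs. \<forall>n m. qpoch (\<beta> * q powi (- int n)) q m \<noteq> 0"
  shows "bilateral_weight as bs q x y (Suc n) (Suc m) = x * bilateral_weight as bs q x y n m"
proof -
  define U where "U = (\<lambda>cs n m. qpochs (map (\<lambda>c. c * q powi (- int n)) cs) q m)"
  define D where "D = (\<lambda>cs n. qpochs (map (\<lambda>c. q / c) cs) q n)"
  define w where "w = - (q ^ Suc n)"
  have w0: "w \<noteq> 0" using assms(1) by (simp add: w_def)
  have PA: "prod_list as \<noteq> 0" and PB: "prod_list bs \<noteq> 0"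
    using as0 bs0 by (auto simp: prod_list_zero_iff)
  have DA: "D as n \<noteq> 0" for n
    unfolding D_def using as by (intro qpochs_nonzero) auto
  have UB: "U bs n m \<noteq> 0" for n m
    unfolding U_def using bs by (intro qpochs_nonzero) auto
  have "U as (Suc n) (Suc m) * D as n * w ^ length as = U as n m * D as (Suc n) * prod_list as"
    using qpochs_diagonal_shift[OF assms(1) as0] by (simp only: U_def D_def w_def)
  then have 1: "U as (Suc n) (Suc m) / D as (Suc n) = U as n m / D as n * prod_list as / (w * w ^ length bs)"
    using DA[of n] DA[of "Suc n"] w0 by (simp add: len divide_simps) (simp add: mult_ac)
  have "U bs (Suc n) (Suc m) * D bs n * w ^ length bs = U bs n m * D bs (Suc n) * prod_list bs"
    using qpochs_diagonal_shift[OF assms(1) bs0] by (simp only: U_def D_def w_def)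
  then have 2: "D bs (Suc n) / U bs (Suc n) (Suc m) = D bs n / U bs n m * w ^ length bs / prod_list bs"
    using UB[of n m] UB[of "Suc n" "Suc m"] PB by (simp add: divide_simps) (simp add: mult_ac)
  have W: "bilateral_weight as bs q x y n m
     = (x * q * prod_list bs / (y * prod_list as)) ^ n * qtau q n * (D bs n / U bs n m) * (U as n m / D as n) * y ^ m" for n m
    by (simp add: bilateral_weight_def U_def D_def)
  have "bilateral_weight as bs q x y (Suc n) (Suc m)
     = (x * q * prod_list bs / (y * prod_list as)) ^ n * qtau q n * (D bs n / U bs n m) * (U as n m / D as n) * y ^ m
        * ((x * q * prod_list bs / (y * prod_list as)) * - (q ^ n) * (w ^ length bs / prod_list bs)
            * (prod_list as / (w * w ^ length bs)) * y)"
    unfolding W 1 2 by (simp add: qtau_Suc mult_ac)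
  also have "(x * q * prod_list bs / (y * prod_list as)) * - (q ^ n) * (w ^ length bs / prod_list bs)
            * (prod_list as / (w * w ^ length bs)) * y = x * (- (q ^ Suc n) / w)"
    using PA PB w0 assms(2) by (simp add: divide_simps)
  also have "- (q ^ Suc n) / w = 1"
    using w0 by (simp add: w_def)
  finally show ?thesis by (simp add: W mult_ac)
qed

text \<open>The pair \<open>q/b\<close>, \<open>q\<^bsup>1-n\<^esup>/b\<close> of the inner series combines with \<open>(b; q)\<^sub>n\<close> into a finite product
  that is polynomial in \<open>b\<close>, as the numerator of \<open>collected_kernel\<close> is.\<close>

lemma shifted_b_quotient:
  fixes q b :: complex
  assumes "q \<noteq> 0" "b \<noteq> 0"
    and nz: "\<And>n m. qpoch (q powi (1 - int n) / b) q m \<noteq> 0"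
  shows "qpoch b q n * qpoch (q / b) q m / qpoch (q powi (1 - int n) / b) q m
       = qtau q n * hpoch b (q powi (int m - int n + 1)) q n"
proof (induction n)
  case 0
  have "qpoch (q / b) q m \<noteq> 0" using nz[of 0 m] by simp
  then show ?case by (simp add: qpoch_def)
next
  case (Suc n)
  define A where "A = q powi (- int n) / b"
  have Aq: "A * q = q powi (1 - int n) / b" "A * q ^ m = q powi (int m - int n) / b" "A * q ^ n = 1 / b"
    using assms(1) by (simp_all add: A_def power_int_diff power_int_minus divide_simps)
  have A: "q powi (1 - int (Suc n)) / b = A" by (simp add: A_def)
  have "qpoch A q m * (1 - A * q ^ m) = (1 - A) * qpoch (A * q) q m"
    using qpoch_Suc[of A q m] qpoch_Suc_shift[of A q m] by simp
  then have 1: "(1 - A) / qpoch A q m = (1 - A * q ^ m) / qpoch (A * q) q m"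
    using nz[of "Suc n" m] nz[of n m] unfolding A Aq(1)[symmetric] by (simp add: field_simps)
  have 2: "1 - b * q ^ n = - b * q ^ n * (1 - A)"
    using Aq(3) assms(2) by (simp add: field_simps)
  have 3: "- b * q ^ n * (1 - A * q ^ m) = - (q ^ n) * (b - q powi (int m - int n))"
    unfolding Aq(2) using assms(2) by (simp add: field_simps)
  have "qpoch b q (Suc n) * qpoch (q / b) q m / qpoch (q powi (1 - int (Suc n)) / b) q m
      = qpoch b q n * qpoch (q / b) q m * (- b * q ^ n) * ((1 - A) / qpoch A q m)"
    unfolding A qpoch_Suc 2 by simp
  also have "\<dots> = (- b * q ^ n * (1 - A * q ^ m)) * (qpoch b q n * qpoch (q / b) q m / qpoch (A * q) q m)"
    unfolding 1 by simp
  also have "\<dots> = - (q ^ n) * (b - q powi (int m - int n)) * (qtau q n * hpoch b (q powi (int m - int n + 1)) q n)"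
    unfolding 3 Aq(1) Suc.IH ..
  also have "\<dots> = qtau q (Suc n) * hpoch b (q powi (int m - int (Suc n) + 1)) q (Suc n)"
  proof -
    have "q powi (int m - int n) * q = q powi (int m - int n + 1)"
      using assms(1) by (simp add: power_int_add)
    then show ?thesis by (simp add: qtau_Suc hpoch_Suc_shift)
  qed
  finally show ?case .
qed

section \<open>The transformations\<close>

lemma kernel_transformation:
  fixes W g :: "nat \<Rightarrow> nat \<Rightarrow> complex"
  assumes q: "0 < norm q" "norm q < 1"
    and nz: "\<And>n. hpoch (c * u) (b * s) q n \<noteq> 0"
    and W: "\<And>n m. W (Suc n) (Suc m) = x * W n m"
    and L: "\<And>n m. L n * g n m = collected_kernel q u s b c n m * W n m"
    and R: "\<And>k n m. R1 k * (R2 k n * h k n m) = expanded_kernel q u s b c k n m * x ^ k * W n m"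
    and sumL: "(\<lambda>(n, m). norm (L n * g n m)) summable_on UNIV"
    and sumR: "(\<lambda>(k, n, m). norm (R1 k * (R2 k n * h k n m))) summable_on UNIV"
  shows "(\<Sum>n. L n * (\<Sum>m. g n m)) = (\<Sum>k. R1 k * (\<Sum>n. R2 k n * (\<Sum>m. h k n m)))"
  unfolding suminf_suminf_mult[OF sumL] suminf_suminf_suminf_mult[OF sumR] L R
  using sumR unfolding R by (rule infsum_kernel[where c = c and u = u and b = b and s = s and W = W and x = x, OF q nz W])

text \<open>Here the right-hand side carries the factor \<open>(x; q)\<^sub>\<infinity> / (x; q)\<^sub>n\<close> in place of the sum over \<open>k\<close>;
  Euler's expansion restores that sum.\<close>

lemma kernel_transformation_euler:
  fixes W g :: "nat \<Rightarrow> nat \<Rightarrow> complex"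
  assumes q: "0 < norm q" "norm q < 1"
    and nz: "\<And>n. hpoch (c * u) (b * s) q n \<noteq> 0"
    and W: "\<And>n m. W (Suc n) (Suc m) = x * W n m"
    and x: "\<And>n. qpoch x q n \<noteq> 0"
    and L: "\<And>n m. L n * g n m = collected_kernel q u s b c n m * W n m"
    and R: "\<And>n m. R n * h n m = V n m / qpoch x q n"
    and V: "\<And>k n m. qtau q k / qpoch q q k * (x * q ^ n) ^ k * V n m
                   = expanded_kernel q u s b c k n m * x ^ k * W n m"
    and sumL: "(\<lambda>(n, m). norm (L n * g n m)) summable_on UNIV"
    and sumR: "(\<lambda>(n, m). norm (R n * h n m)) summable_on UNIV"
  shows "(\<Sum>n. L n * (\<Sum>m. g n m)) = qpoch_inf x q * (\<Sum>n. R n * (\<Sum>m. h n m))"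
proof -
  note sV = sumR[unfolded R]
  have "infsum (\<lambda>(n, m). collected_kernel q u s b c n m * W n m) UNIV
      = infsum (\<lambda>(k, n, m). expanded_kernel q u s b c k n m * x ^ k * W n m) UNIV"
    using euler_expansion_summable[OF q(2) x sV] unfolding V by (rule infsum_kernel[where c = c and u = u and b = b and s = s and W = W and x = x, OF q nz W])
  also have "\<dots> = qpoch_inf x q * infsum (\<lambda>(n, m). V n m / qpoch x q n) UNIV"
    using euler_expansion_infsum[OF q(2) x sV] unfolding V .
  finally show ?thesis
    unfolding suminf_suminf_mult[OF sumL] suminf_suminf_mult[OF sumR] L R .
qed

lemma qtau_nonzero: "q \<noteq> 0 \<Longrightarrow> qtau q n \<noteq> 0"
  by (simp add: qtau_def)

lemma qtau_square: "qtau q n * qtau q n * q ^ n = q ^ (n ^ 2)"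
proof (induction n)
  case (Suc n)
  have "qtau q (Suc n) * qtau q (Suc n) * q ^ Suc n = (qtau q n * qtau q n * q ^ n) * (q * q ^ n * q ^ n)"
    by (simp add: qtau_Suc mult_ac)
  also have "\<dots> = q ^ (n ^ 2) * q ^ (1 + n + n)"
    unfolding Suc.IH by (simp add: power_add)
  also have "\<dots> = q ^ (n ^ 2 + (1 + n + n))"
    by (rule power_add[symmetric])
  also have "n ^ 2 + (1 + n + n) = (Suc n) ^ 2"
    by (simp add: power2_eq_square)
  finally show ?case .
qed simp

theorem theorem3p18:
  fixes q b t x y :: complex and as bs :: "complex list" and r :: nat
  assumes "0 < norm q" "norm q < 1"
    and "r \<ge> 1" "length as = r + 1" "length bs = r"
    and "\<forall>a\<in>set as. a \<noteq> 0" "\<forall>\<beta>\<in>set bs. \<beta> \<noteq> 0"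
    and "b \<noteq> 0" "t \<noteq> 0" "x \<noteq> 0" "y \<noteq> 0"
    and no_zero_factors:
      "\<forall>a\<in>set as. \<forall>n. qpoch (q / a) q n \<noteq> 0"
      "\<forall>\<beta>\<in>set bs. \<forall>n m. qpoch (\<beta> * q powi (- int n)) q m \<noteq> 0"
  shows
    "(let X = x * q * prod_list bs / (y * prod_list as);
          qas = map (\<lambda>a. q / a) as;
          qbs = map (\<lambda>\<beta>. q / \<beta>) bs;
          as' = (\<lambda>n. map (\<lambda>a. a * q powi (- int n)) as);
          bs' = (\<lambda>n. map (\<lambda>\<beta>. \<beta> * q powi (- int n)) bs);
          L = (\<lambda>n. qtau q n / qpoch q q n
                 * (qpochs (b # t # qbs) q n / qpochs (b * t # qas) q n) * X ^ n);
          R1 = (\<lambda>k. qtau q k * x ^ k / qpoch q q k);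
          R2 = (\<lambda>k n. qtau q n / qpoch q q n
                 * (qpochs (qbs @ [b, t * q ^ k]) q n / qpochs (qas @ [b * t]) q n) * X ^ n)
      in (\<forall>n. qpoch (b * t) q n \<noteq> 0) \<longrightarrow>
         (\<forall>n m. qpoch (q powi (1 - int n) / b) q m \<noteq> 0) \<longrightarrow>
         (\<forall>k m. qpoch (t * q ^ k) q m \<noteq> 0) \<longrightarrow>
         (\<lambda>(n, m). norm (L n
            * qhyp_term (as' n @ [q / b]) (bs' n @ [q powi (1 - int n) / b]) q y m))
           summable_on UNIV \<longrightarrow>
         (\<lambda>(k, n, m). norm (R1 k * (R2 k n
            * qhyp_term (as' n @ [t * q ^ (k + n)]) (bs' n @ [t * q ^ k]) q y m)))
           summable_on UNIV \<longrightarrow>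
         (\<Sum>n. L n * qhyp (as' n @ [q / b]) (bs' n @ [q powi (1 - int n) / b]) q y)
         = (\<Sum>k. R1 k *
              (\<Sum>n. R2 k n * qhyp (as' n @ [t * q ^ (k + n)]) (bs' n @ [t * q ^ k]) q y)))
   \<and>
     (let X = x * q * prod_list bs / (y * b * prod_list as);
          qas = map (\<lambda>a. q / a) as;
          qbs = map (\<lambda>\<beta>. q / \<beta>) bs;
          as' = (\<lambda>n. map (\<lambda>a. a * q powi (- int n)) as);
          bs' = (\<lambda>n. map (\<lambda>\<beta>. \<beta> * q powi (- int n)) bs);
          L = (\<lambda>n. qtau q n / qpoch q q n
                 * (qpochs (b # qbs) q n / qpochs qas q n) * X ^ n);
          R = (\<lambda>n. qtau q n / qpochs [q, x] q n
                 * (qpochs (qbs @ [b]) q n / qpochs qas q n) * X ^ n)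
      in (\<forall>n m. qpoch (q powi (1 - int n) / b) q m \<noteq> 0) \<longrightarrow>
         (\<forall>n. qpoch x q n \<noteq> 0) \<longrightarrow>
         (\<lambda>(n, m). norm (L n
            * qhyp_term (as' n @ [q / b]) (bs' n @ [q powi (1 - int n) / b]) q y m))
           summable_on UNIV \<longrightarrow>
         (\<lambda>(n, m). norm (R n * qhyp_term (as' n) (bs' n) q (y * q ^ n) m))
           summable_on UNIV \<longrightarrow>
         (\<Sum>n. L n * qhyp (as' n @ [q / b]) (bs' n @ [q powi (1 - int n) / b]) q y)
         = qpoch_inf x q * (\<Sum>n. R n * qhyp (as' n) (bs' n) q (y * q ^ n)))
   \<and>
     (let X = x * prod_list bs / (y * prod_list as);
          qas = map (\<lambda>a. q / a) as;
          qbs = map (\<lambda>\<beta>. q / \<beta>) bs;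
          as' = (\<lambda>n. map (\<lambda>a. a * q powi (- int n)) as);
          bs' = (\<lambda>n. map (\<lambda>\<beta>. \<beta> * q powi (- int n)) bs);
          L = (\<lambda>n. q ^ (n ^ 2) / qpoch q q n * (qpochs qbs q n / qpochs qas q n) * X ^ n);
          R = (\<lambda>n. q ^ (n ^ 2) / qpochs [q, x] q n * (qpochs qbs q n / qpochs qas q n) * X ^ n)
      in (\<forall>n. qpoch x q n \<noteq> 0) \<longrightarrow>
         (\<lambda>(n, m). norm (L n * qhyp_term (as' n) (bs' n) q y m)) summable_on UNIV \<longrightarrow>
         (\<lambda>(n, m). norm (R n * qhyp_term (as' n) (bs' n) q (y * q ^ n) m))
           summable_on UNIV \<longrightarrow>
         (\<Sum>n. L n * qhyp (as' n) (bs' n) q y)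
         = qpoch_inf x q * (\<Sum>n. R n * qhyp (as' n) (bs' n) q (y * q ^ n)))"
proof -
  note q = assms(1,2) and len = assms(4,5) and as0 = assms(6) and bs0 = assms(7)
  have q0: "q \<noteq> 0" using q(1) by auto
  have len': "length as = Suc (length bs)" using len by simp
  define W where "W = bilateral_weight as bs q x y"
  have W: "W (Suc n) (Suc m) = x * W n m" for n m
    unfolding W_def
    by (rule bilateral_weight_Suc_Suc[OF q0 \<open>y \<noteq> 0\<close> len' as0 bs0 no_zero_factors])
  note term_simps = W_def bilateral_weight_def qhyp_term_balanced len' power_mult_distrib power_divide
  have collected: "collected_kernel q u s b 1 n m = hpoch u s q n
       * (qpoch b q n * qpoch (q / b) q m / qpoch (q powi (1 - int n) / b) q m)
       / (qpoch q q n * hpoch u (b * s) q n * qpoch q q m)"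
    if "\<forall>n m. qpoch (q powi (1 - int n) / b) q m \<noteq> 0" for u s n m
    using shifted_b_quotient[OF q0 \<open>b \<noteq> 0\<close>, of n m] that by (simp add: collected_kernel_def mult_ac)
  show ?thesis
    unfolding Let_def qhyp_def
  proof (intro conjI impI, goal_cases)
    case 1
    note bt = 1(1) and b = 1(2) and t = 1(3) and sums = 1(4,5)
    show ?case
    proof (rule kernel_transformation[where c = 1 and u = 1 and s = t and b = b and W = W and x = x, OF q _ W _ _ sums])
      show "hpoch (1 * 1) (b * t) q n \<noteq> 0" for n
        using bt by (simp add: hpoch_one)
    next
      fix n m
      show "qtau q n / qpoch q q n * (qpochs (b # t # map (\<lambda>\<beta>. q / \<beta>) bs) q n / qpochs (b * t # map (\<lambda>a. q / a) as) q n)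
          * (x * q * prod_list bs / (y * prod_list as)) ^ n
          * qhyp_term (map (\<lambda>a. a * q powi - int n) as @ [q / b])
              (map (\<lambda>\<beta>. \<beta> * q powi - int n) bs @ [q powi (1 - int n) / b]) q y m
        = collected_kernel q 1 t b 1 n m * W n m"
        by (simp add: collected[OF b] term_simps hpoch_one mult_ac)
    next
      fix k n m
      have "qpoch (t * q ^ k) q n * qpoch (t * q ^ (k + n)) q m / qpoch (t * q ^ k) q m = qpoch (t * q ^ (k + m)) q n"
        using qpoch_mult_shift[of "t * q ^ k" q n m] t by (simp add: power_add mult_ac)
      then have e: "expanded_kernel q 1 t b 1 k n m = qtau q k * qpoch b q n
          * (qpoch (t * q ^ k) q n * qpoch (t * q ^ (k + n)) q m / qpoch (t * q ^ k) q m)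
          / (qpoch q q k * qpoch q q n * qpoch (b * t) q n * qpoch q q m)"
        by (simp add: expanded_kernel_def hpoch_one)
      show "qtau q k * x ^ k / qpoch q q k
          * (qtau q n / qpoch q q n
            * (qpochs (map (\<lambda>\<beta>. q / \<beta>) bs @ [b, t * q ^ k]) q n / qpochs (map (\<lambda>a. q / a) as @ [b * t]) q n)
            * (x * q * prod_list bs / (y * prod_list as)) ^ n
            * qhyp_term (map (\<lambda>a. a * q powi - int n) as @ [t * q ^ (k + n)])
                (map (\<lambda>\<beta>. \<beta> * q powi - int n) bs @ [t * q ^ k]) q y m)
        = expanded_kernel q 1 t b 1 k n m * x ^ k * W n m"
        unfolding e by (simp add: term_simps mult_ac)
    qed
  next
    case 2
    note b = 2(1) and x = 2(2) and sums = 2(3,4)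
    \<comment> \<open>\<open>u = 0\<close>, \<open>s = 1\<close> stands for \<open>t\<close> tending to infinity: \<open>(t; q)\<^sub>n / (bt; q)\<^sub>n\<close> becomes \<open>b\<^sup>-\<^sup>n\<close>,
      and \<open>(tq\<^bsup>k+m\<^esup>; q)\<^sub>n / (bt; q)\<^sub>n\<close> becomes \<open>q\<^bsup>(k+m)n\<^esup> b\<^sup>-\<^sup>n\<close>, in which \<open>q\<^bsup>kn\<^esup>\<close> joins \<open>x\<^sup>k\<close>.\<close>
    define V where "V = (\<lambda>n m. qpoch b q n * q ^ (n * m) / (b ^ n * qpoch q q n * qpoch q q m) * W n m)"
    show ?case
    proof (rule kernel_transformation_euler[where c = 1 and u = 0 and s = 1 and b = b and W = W and V = V, OF q _ W _ _ _ _ sums])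
      show "hpoch (1 * 0) (b * 1) q n \<noteq> 0" for n
        using \<open>b \<noteq> 0\<close> qtau_nonzero[OF q0] by (simp add: hpoch_zero_left)
      show "qpoch x q n \<noteq> 0" for n
        using x by blast
    next
      fix n m
      show "qtau q n / qpoch q q n * (qpochs (b # map (\<lambda>\<beta>. q / \<beta>) bs) q n / qpochs (map (\<lambda>a. q / a) as) q n)
          * (x * q * prod_list bs / (y * b * prod_list as)) ^ n
          * qhyp_term (map (\<lambda>a. a * q powi - int n) as @ [q / b])
              (map (\<lambda>\<beta>. \<beta> * q powi - int n) bs @ [q powi (1 - int n) / b]) q y m
        = collected_kernel q 0 1 b 1 n m * W n m"
        using qtau_nonzero[OF q0, of n] by (simp add: collected[OF b] term_simps hpoch_zero_left mult_ac)
      show "qtau q n / qpochs [q, x] q n * (qpochs (map (\<lambda>\<beta>. q / \<beta>) bs @ [b]) q n / qpochs (map (\<lambda>a. q / a) as) q n)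
          * (x * q * prod_list bs / (y * b * prod_list as)) ^ n
          * qhyp_term (map (\<lambda>a. a * q powi - int n) as) (map (\<lambda>\<beta>. \<beta> * q powi - int n) bs) q (y * q ^ n) m
        = V n m / qpoch x q n"
        by (simp add: V_def term_simps power_mult mult_ac)
      show "qtau q k / qpoch q q k * (x * q ^ n) ^ k * V n m = expanded_kernel q 0 1 b 1 k n m * x ^ k * W n m" for k
        using qtau_nonzero[OF q0, of n]
        by (simp add: V_def expanded_kernel_def hpoch_zero_left hpoch_one power_mult_distrib power_add power_mult[symmetric] mult_ac)
    qed
  next
    case 3
    note x = 3(1) and sums = 3(2,3)
    \<comment> \<open>\<open>c = 0\<close>, \<open>b = 1\<close> stands for \<open>b\<close> tending to infinity: \<open>(b; q)\<^sub>n b\<^sup>-\<^sup>n\<close> becomes \<open>\<tau>(n)\<close>, and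
      \<open>\<tau>(n)\<^sup>2 q\<^sup>n = q\<^bsup>n*n\<^esup>\<close>.\<close>
    define V where "V = (\<lambda>n m. qtau q n * q ^ (n * m) / (qpoch q q n * qpoch q q m) * W n m)"
    show ?case
    proof (rule kernel_transformation_euler[where c = 0 and u = 0 and s = 1 and b = 1 and W = W and V = V, OF q _ W _ _ _ _ sums])
      show "hpoch (0 * 0) (1 * 1) q n \<noteq> 0" for n
        using qtau_nonzero[OF q0] by (simp add: hpoch_zero_left)
      show "qpoch x q n \<noteq> 0" for n
        using x by blast
    next
      fix n m
      show "q ^ n ^ 2 / qpoch q q n * (qpochs (map (\<lambda>\<beta>. q / \<beta>) bs) q n / qpochs (map (\<lambda>a. q / a) as) q n)
          * (x * prod_list bs / (y * prod_list as)) ^ n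
          * qhyp_term (map (\<lambda>a. a * q powi - int n) as) (map (\<lambda>\<beta>. \<beta> * q powi - int n) bs) q y m
        = collected_kernel q 0 1 1 0 n m * W n m"
        using qtau_nonzero[OF q0, of n]
        by (simp add: qtau_square[symmetric] collected_kernel_def term_simps hpoch_zero_left hpoch_def[of 1 0] mult_ac)
      show "q ^ n ^ 2 / qpochs [q, x] q n * (qpochs (map (\<lambda>\<beta>. q / \<beta>) bs) q n / qpochs (map (\<lambda>a. q / a) as) q n)
          * (x * prod_list bs / (y * prod_list as)) ^ n
          * qhyp_term (map (\<lambda>a. a * q powi - int n) as) (map (\<lambda>\<beta>. \<beta> * q powi - int n) bs) q (y * q ^ n) m
        = V n m / qpoch x q n"
        by (simp add: qtau_square[symmetric] V_def term_simps power_mult mult_ac)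
      show "qtau q k / qpoch q q k * (x * q ^ n) ^ k * V n m = expanded_kernel q 0 1 1 0 k n m * x ^ k * W n m" for k
        using qtau_nonzero[OF q0, of n]
        by (simp add: V_def expanded_kernel_def hpoch_zero_left power_mult_distrib power_add power_mult[symmetric] mult_ac)
    qed
  qed
qed

end
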